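(* For each integer $k\ge 0$, let $a_k$ denote the number of $(3,1)$-regular vertex-labelled graphs having $2k$ vertices and $2k-1$ edges (Sequence A339987 of the OEIS). Then, for all integers $k\ge 0$, $$ \begin{aligned} & 32\,(328k^3 + 3300k^2 + 10844k + 11589)\,(k+1)(k+2)(2k+1)(2k+3)(2k+5)(2k+7)(2k+9)\, a_k \\ &- 8\,(2624k^4 + 30664k^3 + 129460k^2 + 232328k + 148119)\,(k+2)(2k+3)(2k+5)(2k+7)(2k+9)\, a_{k+1} \\ &- 16\,(2952k^5 + 40852k^4 + 219308k^3 + 569267k^2 + 712135k + 341634)\,(k+3)(2k+5)(2k+7)(2k+9)\, a_{k+2} \\ &+ 8\,(3936k^5 + 55672k^4 + 306380k^3 + 818282k^2 + 1057879k + 527520)\,(k+4)(2k+7)(2k+9)\, a_{k+3} \\ &- 2\,(2624k^5 + 42472k^4 + 264028k^3 + 786236k^2 + 1117119k + 601452)\,(k+5)(2k+9)\, a_{k+4} \\ &+ 3\,(328k^3 + 2316k^2 + 5228k + 3717)\,(k+4)(k+6)\, a_{k+5} \;=\; 0 . \end{aligned} $$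
   Context: Graphs are finite simple undirected graphs (no loops, no multiple edges), not necessarily connected. A vertex-labelled graph on $n$ vertices has vertex set $\{1,\dots,n\}$ (edges are unlabelled), and two such graphs are counted as different when their edge sets differ. A graph is $(3,1)$-regular if every one of its vertices has degree $3$ or degree $1$. A $(3,1)$-regular graph with $2k$ vertices and $2k-1$ edges, $k\ge 1$, is the same as a graph with exactly $k-1$ vertices of degree $3$ and $k+1$ vertices of degree $1$. For $k=0$ there is no graph with $-1$ edges, so $a_0=0$. The sequence $(a_k)_{k\ge0}$ starts $0, 1, 4, 90, 8400, 1426950, 366153480, 134292027870,\dots$ *)

theory Defs
  imports Complex_Main "HOL-Library.Ramsey"
begin

text \<open>
  A labelled simple graph on the vertex set \<open>{1..n}\<close> is represented by its edge set: a set of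
  two-element subsets of \<open>{1..n}\<close>. Isolated vertices cause no ambiguity because \<open>n\<close> is always given.
\<close>

definition labelled_graphs :: "nat \<Rightarrow> nat set set set" where
  "labelled_graphs n = {E. E \<subseteq> nsets {1..n} 2}"

definition vdegree :: "nat set set \<Rightarrow> nat \<Rightarrow> nat" where
  "vdegree E v = card {e \<in> E. v \<in> e}"

definition regular_3_1 :: "nat \<Rightarrow> nat set set \<Rightarrow> bool" where
  "regular_3_1 n E \<longleftrightarrow> (\<forall>v \<in> {1..n}. vdegree E v = 3 \<or> vdegree E v = 1)"

text \<open>
  The number of edges is compared in \<open>int\<close>: with truncated subtraction on \<open>nat\<close>, the empty graph
  would be counted for \<open>k = 0\<close>.
\<close>

definition a339987 :: "nat \<Rightarrow> nat" where
  "a339987 k = card {E \<in> labelled_graphs (2 * k). regular_3_1 (2 * k) E \<and> int (card E) = 2 * int k - 1}"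

end

theory Submission
  imports Defs
begin

text \<open>
  Let \<open>N n s\<close> be the number of graphs in which \<open>n\<close> prescribed vertices have degree 3 and \<open>s\<close> prescribed
  vertices have degree 1. Counting the neighbourhoods of a removed vertex, and comparing a vertex of
  degree 2 or 3 with the two or three leaves obtained by splitting it, gives two recurrences in which
  no vertices of degree 2 occur:
  \<open>2 N(n+1, t+2) = 2 (t+1) N(n+1, t) + (n+1) (N(n, t+3) - N(n, t+1) - n N(n-1, t+2))\<close> and
  \<open>N(n, s+3) = 6 N(n+1, s) + 3 N(n, s+1) + 3 n N(n-1, s+2) - 2 n N(n-1, s)\<close>.
  By the handshake lemma, \<open>a k\<close> is \<open>N (k-1) (k+1)\<close> times a binomial coefficient, and the claimed
  recurrence is a linear combination, with polynomial coefficients in \<open>k\<close>, of twelve instances of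
  these two relations.
\<close>

section \<open>Removing a vertex\<close>

text \<open>
  Degrees are prescribed in \<open>int\<close>: lowering a degree below zero then makes the count vanish, and
  neighbours of degree zero need no separate treatment when a vertex is removed.
\<close>

definition realizations :: "nat set \<Rightarrow> (nat \<Rightarrow> int) \<Rightarrow> nat" where
  "realizations V d = card {E. E \<subseteq> nsets V 2 \<and> (\<forall>v\<in>V. int (vdegree E v) = d v)}"

definition lower :: "nat set \<Rightarrow> (nat \<Rightarrow> int) \<Rightarrow> nat \<Rightarrow> int" where
  "lower S d = (\<lambda>u. d u - of_bool (u \<in> S))"

lemma nsets_2_insert:
  assumes "v \<notin> V"
  shows "nsets (insert v V) 2 = nsets V 2 \<union> (\<lambda>u. {v, u}) ` V"
proof -
  have "e \<in> nsets (insert v V) 2 \<longleftrightarrow> e \<in> nsets V 2 \<union> (\<lambda>u. {v, u}) ` V" for e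
    using assms unfolding nsets_def card_2_iff by (auto simp: doubleton_eq_iff image_iff; blast)
  then show ?thesis by blast
qed

lemma vdegree_attach:
  assumes "finite V" "v \<notin> V" "S \<subseteq> V" "E \<subseteq> nsets V 2"
  shows "vdegree (E \<union> (\<lambda>u. {v, u}) ` S) v = card S"
    and "w \<in> V \<Longrightarrow> vdegree (E \<union> (\<lambda>u. {v, u}) ` S) w = vdegree E w + of_bool (w \<in> S)"
proof -
  have v: "v \<notin> e" if "e \<in> E" for e using that assms by (auto simp: nsets_def)
  have "{e \<in> E \<union> (\<lambda>u. {v, u}) ` S. v \<in> e} = (\<lambda>u. {v, u}) ` S" using v by auto
  moreover have "inj_on (\<lambda>u. {v, u}) S" by (auto simp: inj_on_def doubleton_eq_iff)
  ultimately show "vdegree (E \<union> (\<lambda>u. {v, u}) ` S) v = card S"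
    by (simp add: vdegree_def card_image)
  assume w: "w \<in> V"
  have fin: "finite {e \<in> E. w \<in> e}"
    using assms finite_imp_finite_nsets finite_subset by fastforce
  have "{e \<in> E \<union> (\<lambda>u. {v, u}) ` S. w \<in> e} = (if w \<in> S then insert {v, w} {e \<in> E. w \<in> e} else {e \<in> E. w \<in> e})"
    using w assms(2) by auto
  moreover have "{v, w} \<notin> {e \<in> E. w \<in> e}" using v by auto
  ultimately show "vdegree (E \<union> (\<lambda>u. {v, u}) ` S) w = vdegree E w + of_bool (w \<in> S)"
    using fin by (simp add: vdegree_def)
qed

text \<open>A graph on \<open>insert v V\<close> amounts to the neighbourhood \<open>S\<close> of
  \<open>v\<close> together with the graph left on \<open>V\<close> after deleting \<open>v\<close>,
  in which exactly the vertices of \<open>S\<close> have lost one degree.\<close>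

lemma realizations_insert:
  assumes V: "finite V" "v \<notin> V" and dv: "d v = int r"
  shows "realizations (insert v V) d = (\<Sum>S \<in> nsets V r. realizations V (lower S d))"
proof -
  define A where "A = (\<lambda>S. {E. E \<subseteq> nsets V 2 \<and> (\<forall>w\<in>V. int (vdegree E w) = lower S d w)})"
  define B where "B = {E. E \<subseteq> nsets (insert v V) 2 \<and> (\<forall>w\<in>insert v V. int (vdegree E w) = d w)}"
  define f where "f = (\<lambda>(S, E). E \<union> (\<lambda>u. {v, u}) ` S)"
  define g where "g = (\<lambda>E. ({u \<in> V. {v, u} \<in> E}, {e \<in> E. v \<notin> e}))"
  have decomp: "f (g E) = E" if "E \<subseteq> nsets (insert v V) 2" for E
  proof -
    have "\<exists>u\<in>V. e = {v, u}" if "e \<in> E" "v \<in> e" for e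
    proof -
      have "e \<in> nsets V 2 \<union> (\<lambda>u. {v, u}) ` V"
        using that \<open>E \<subseteq> _\<close> nsets_2_insert[OF V(2)] by auto
      then show ?thesis using that V by (auto simp: nsets_def)
    qed
    then show ?thesis by (auto simp: f_def g_def)
  qed
  have gE: "fst (g E) \<subseteq> V" "snd (g E) \<subseteq> nsets V 2" if "E \<subseteq> nsets (insert v V) 2" for E
    using that V by (auto simp: g_def nsets_2_insert)
  have sub: "S \<subseteq> V" "card S = r" "finite S" if "S \<in> nsets V r" for S using that by (auto simp: nsets_def)
  have "bij_betw f (Sigma (nsets V r) A) B"
  proof (rule bij_betw_byWitness[where f' = g])
    show "\<forall>a\<in>Sigma (nsets V r) A. g (f a) = a"
    proof clarify
      fix S E assume S: "S \<in> nsets V r" and E: "E \<in> A S"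
      have "v \<notin> e" if "e \<in> E" for e using E that V by (auto simp: A_def nsets_def)
      then show "g (f (S, E)) = (S, E)"
        using sub[OF S] V by (auto simp: f_def g_def doubleton_eq_iff)
    qed
    show "\<forall>a'\<in>B. f (g a') = a'" using decomp by (auto simp: B_def)
    show "f ` Sigma (nsets V r) A \<subseteq> B"
    proof clarify
      fix S E assume S: "S \<in> nsets V r" and E: "E \<in> A S"
      have E': "E \<subseteq> nsets V 2" using E by (simp add: A_def)
      show "f (S, E) \<in> B"
        using E E' sub[OF S] dv vdegree_attach[OF V sub(1)[OF S] E']
        by (auto simp: B_def f_def A_def nsets_2_insert[OF V(2)] lower_def)
    qed
    show "g ` B \<subseteq> Sigma (nsets V r) A"
    proof (rule image_subsetI)
      fix E assume E: "E \<in> B"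
      obtain S E' where g: "g E = (S, E')" by force
      have *: "E \<subseteq> nsets (insert v V) 2" using E by (simp add: B_def)
      have s: "S \<subseteq> V" "E' \<subseteq> nsets V 2" "E = E' \<union> (\<lambda>u. {v, u}) ` S"
        using gE[OF *] decomp[OF *] g by (auto simp: f_def)
      have deg: "int (vdegree E w) = d w" if "w \<in> insert v V" for w using E that by (auto simp: B_def)
      have "card S = r" using deg[of v] vdegree_attach(1)[OF V s(1,2)] s(3) dv by simp
      moreover have "int (vdegree E' w) = lower S d w" if "w \<in> V" for w
        using deg[of w] vdegree_attach(2)[OF V s(1,2) that] s(3) that by (simp add: lower_def)
      ultimately show "g E \<in> Sigma (nsets V r) A"
        using s V finite_subset[of S V] unfolding g by (auto simp: nsets_def A_def)
    qed
  qed
  then have "card B = card (Sigma (nsets V r) A)" by (simp add: bij_betw_same_card)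
  also have "\<dots> = (\<Sum>S \<in> nsets V r. card (A S))"
    using V finite_subset[OF _ finite_imp_finite_nsets[OF V(1)]]
    by (intro card_SigmaI) (auto simp: A_def finite_imp_finite_nsets)
  finally show ?thesis by (simp add: realizations_def A_def B_def)
qed

lemma realizations_cong: "(\<And>v. v \<in> V \<Longrightarrow> d v = d' v) \<Longrightarrow> realizations V d = realizations V d'"
  by (simp add: realizations_def)

lemma realizations_negative: "v \<in> V \<Longrightarrow> d v < 0 \<Longrightarrow> realizations V d = 0"
proof -
  assume *: "v \<in> V" "d v < 0"
  have "\<not> (\<forall>v\<in>V. int (vdegree E v) = d v)" for E
  proof
    assume "\<forall>v\<in>V. int (vdegree E v) = d v"
    then have "int (vdegree E v) = d v" using *(1) by blast
    then show False using *(2) by linarith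
  qed
  then show ?thesis unfolding realizations_def card_eq_0_iff by blast
qed

lemma realizations_insert_0: "finite V \<Longrightarrow> v \<notin> V \<Longrightarrow> d v = 0 \<Longrightarrow> realizations (insert v V) d = realizations V d"
  using realizations_insert[of V v d 0] by (simp add: nsets_zero lower_def)

lemma realizations_remove_zeros:
  assumes "finite V" "Z \<subseteq> V" "\<And>v. v \<in> Z \<Longrightarrow> d v = 0"
  shows "realizations V d = realizations (V - Z) d"
proof -
  have "finite Z" using assms finite_subset by blast
  then show ?thesis using assms(2,3)
  proof (induction Z)
    case (insert z Z)
    have "realizations (V - Z) d = realizations (insert z (V - insert z Z)) d"
      by (rule arg_cong[where f = "\<lambda>W. realizations W d"]) (use insert in auto)
    also have "\<dots> = realizations (V - insert z Z) d"
      using insert.prems assms(1) by (intro realizations_insert_0) auto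
    finally show ?case using insert by simp
  qed simp
qed

text \<open>Relabelling along \<open>f\<close> preserves degrees. A graph is a set of sets, so
  \<open>f\<close> acts on it through two nested images.\<close>

lemma realizations_bij:
  assumes f: "bij_betw f V V'" and d: "\<And>v. v \<in> V \<Longrightarrow> d' (f v) = d v"
  shows "realizations V' d' = realizations V d"
proof -
  have inj: "inj_on f V" and im: "f ` V = V'" using f by (auto simp: bij_betw_def)
  have b: "bij_betw ((`) ((`) f)) (Pow (nsets V 2)) (Pow (nsets V' 2))"
    by (intro bij_betw_Pow bij_betw_nsets f)
  have deg: "vdegree ((`) f ` E) (f v) = vdegree E v" if E: "E \<subseteq> nsets V 2" and v: "v \<in> V" for E v
  proof -
    have EV: "e \<subseteq> V" if "e \<in> E" for e using E that by (auto simp: nsets_def)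
    have "{e \<in> (`) f ` E. f v \<in> e} = (`) f ` {e \<in> E. v \<in> e}"
      using inj_on_image_mem_iff[OF inj v EV] by auto
    moreover have "inj_on ((`) f) {e \<in> E. v \<in> e}"
      by (rule inj_on_subset[OF inj_on_image_Pow[OF inj]]) (use EV in auto)
    ultimately show ?thesis by (simp add: vdegree_def card_image)
  qed
  have "bij_betw ((`) ((`) f)) {E \<in> Pow (nsets V 2). \<forall>v\<in>V. int (vdegree E v) = d v}
     {E \<in> Pow (nsets V' 2). \<forall>v\<in>V'. int (vdegree E v) = d' v}"
    using b by (rule bij_betw_Collect) (use deg d in \<open>auto simp: im[symmetric]\<close>)
  from bij_betw_same_card[OF this] show ?thesis by (simp add: realizations_def)
qed


section \<open>Expansion over the neighbours of vertices of degree 1, 2 and 3\<close>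

lemma realizations_insert_leaf:
  assumes "finite V" "v \<notin> V" "d v = 1"
  shows "realizations (insert v V) d = (\<Sum>u\<in>V. realizations V (lower {u} d))"
proof -
  have "nsets V 1 = (\<lambda>u. {u}) ` V" by (simp add: nsets_one)
  then show ?thesis
    using realizations_insert[of V v d 1] assms by (simp add: sum.reindex)
qed

text \<open>Double counting of sets of size \<open>Suc r\<close> with one distinguished element.
  Repeated use turns a sum over neighbourhoods into a sum over ordered tuples of distinct
  neighbours.\<close>

lemma sum_nsets_Suc:
  fixes h :: "'a set \<Rightarrow> nat"
  assumes "finite V"
  shows "(\<Sum>u\<in>V. \<Sum>S\<in>nsets (V - {u}) r. h (insert u S)) = Suc r * (\<Sum>T\<in>nsets V (Suc r). h T)"
proof -
  have "(\<Sum>u\<in>V. \<Sum>S\<in>nsets (V - {u}) r. h (insert u S))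
      = (\<Sum>(u, S)\<in>Sigma V (\<lambda>u. nsets (V - {u}) r). h (insert u S))"
    using assms by (simp add: sum.Sigma finite_imp_finite_nsets)
  also have "\<dots> = (\<Sum>(T, u)\<in>Sigma (nsets V (Suc r)) (\<lambda>T. T). h T)"
    by (rule sum.reindex_bij_witness[where i = "\<lambda>(T, u). (u, T - {u})" and j = "\<lambda>(u, S). (insert u S, u)"])
       (auto simp: nsets_def insert_absorb card_insert_if)
  also have "\<dots> = (\<Sum>T\<in>nsets V (Suc r). \<Sum>u\<in>T. h T)"
    using assms by (subst sum.Sigma) (auto simp: finite_imp_finite_nsets nsets_def)
  also have "\<dots> = (\<Sum>T\<in>nsets V (Suc r). Suc r * h T)"
    by (rule sum.cong) (auto simp: nsets_def)
  finally show ?thesis by (simp add: sum_distrib_left)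
qed

lemma lower_insert: "u \<notin> S \<Longrightarrow> lower (insert u S) d = lower S (lower {u} d)"
  by (auto simp: lower_def fun_eq_iff)

lemma lower_commute: "lower {u} (lower {w} d) = lower {w} (lower {u} d)"
  by (auto simp: lower_def fun_eq_iff)

lemma realizations_insert_degree_2:
  assumes "finite V" "v \<notin> V" "d v = 2"
  shows "2 * realizations (insert v V) d = (\<Sum>u\<in>V. \<Sum>w\<in>V-{u}. realizations V (lower {w} (lower {u} d)))"
proof -
  have "2 * realizations (insert v V) d = (\<Sum>u\<in>V. \<Sum>S\<in>nsets (V - {u}) 1. realizations V (lower (insert u S) d))"
    using realizations_insert[of V v d 2] assms sum_nsets_Suc[of V "\<lambda>S. realizations V (lower S d)" 1]
    by (simp add: numeral_2_eq_2)
  also have "\<dots> = (\<Sum>u\<in>V. \<Sum>w\<in>V-{u}. realizations V (lower {w} (lower {u} d)))"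
    by (intro sum.cong) (auto simp: nsets_one sum.reindex lower_insert[symmetric] insert_commute)
  finally show ?thesis .
qed

text \<open>Each neighbourhood has 3! orderings: distinguishing a first neighbour gives the factor
  3, a second one the factor 2.\<close>

lemma realizations_insert_degree_3:
  assumes "finite V" "v \<notin> V" "d v = 3"
  shows "6 * realizations (insert v V) d =
    (\<Sum>u\<in>V. \<Sum>w\<in>V-{u}. \<Sum>x\<in>V-{u}-{w}. realizations V (lower {x} (lower {w} (lower {u} d))))"
proof -
  have "3 * realizations (insert v V) d = (\<Sum>u\<in>V. \<Sum>S\<in>nsets (V - {u}) 2. realizations V (lower (insert u S) d))"
    using realizations_insert[of V v d 3] assms sum_nsets_Suc[of V "\<lambda>S. realizations V (lower S d)" 2]
    by (simp add: eval_nat_numeral)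
  then have "6 * realizations (insert v V) d = (\<Sum>u\<in>V. 2 * (\<Sum>S\<in>nsets (V - {u}) 2. realizations V (lower (insert u S) d)))"
    by (simp add: sum_distrib_left[symmetric])
  also have "\<dots> = (\<Sum>u\<in>V. \<Sum>w\<in>V-{u}. \<Sum>S\<in>nsets (V-{u}-{w}) 1. realizations V (lower (insert u (insert w S)) d))"
    using assms sum_nsets_Suc[of "V - {u}" "\<lambda>S. realizations V (lower (insert u S) d)" 1 for u]
    by (intro sum.cong) (auto simp: numeral_2_eq_2)
  also have "\<dots> = (\<Sum>u\<in>V. \<Sum>w\<in>V-{u}. \<Sum>x\<in>V-{u}-{w}. realizations V (lower {x} (lower {w} (lower {u} d))))"
  proof (intro sum.cong refl)
    fix u w assume "u \<in> V" "w \<in> V - {u}"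
    moreover have "lower {u, w, x} d = lower {x} (lower {w} (lower {u} d))" if "x \<in> V-{u}-{w}" for x
      using that calculation by (auto simp: lower_def fun_eq_iff)
    ultimately show "(\<Sum>S\<in>nsets (V-{u}-{w}) 1. realizations V (lower (insert u (insert w S)) d)) =
       (\<Sum>x\<in>V-{u}-{w}. realizations V (lower {x} (lower {w} (lower {u} d))))"
      by (simp add: nsets_one sum.reindex)
  qed
  finally show ?thesis .
qed

text \<open>Either \<open>p\<close> and \<open>q\<close> are adjacent, or they hang on
  \<open>u\<close> and \<open>w\<close>. Two leaves may share their neighbour, hence both sums run
  over all of \<open>V\<close>.\<close>

lemma realizations_insert_two_leaves:
  assumes V: "finite V" "p \<notin> V" "q \<notin> V" "p \<noteq> q" and d: "d p = 1" "d q = 1"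
  shows "realizations (insert p (insert q V)) d =
    realizations V d + (\<Sum>u\<in>V. \<Sum>w\<in>V. realizations V (lower {w} (lower {u} d)))"
proof -
  have "realizations (insert p (insert q V)) d =
      realizations (insert q V) (lower {q} d) + (\<Sum>u\<in>V. realizations (insert q V) (lower {u} d))"
    using assms by (subst realizations_insert_leaf) auto
  also have "realizations (insert q V) (lower {q} d) = realizations V (lower {q} d)"
    using assms by (intro realizations_insert_0) (auto simp: lower_def)
  also have "\<dots> = realizations V d" using V by (intro realizations_cong) (auto simp: lower_def)
  also have "(\<Sum>u\<in>V. realizations (insert q V) (lower {u} d)) = (\<Sum>u\<in>V. \<Sum>w\<in>V. realizations V (lower {w} (lower {u} d)))"
    using assms by (intro sum.cong refl realizations_insert_leaf) (auto simp: lower_def)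
  finally show ?thesis .
qed

text \<open>The first term covers the three choices of an adjacent pair of leaves, the remaining
  leaf hanging on \<open>u\<close>. Otherwise every leaf has its neighbour in \<open>V\<close>,
  coincidences allowed.\<close>

lemma realizations_insert_three_leaves:
  assumes V: "finite V" "p \<notin> V" "q \<notin> V" "r \<notin> V" "p \<noteq> q" "p \<noteq> r" "q \<noteq> r"
    and d: "d p = 1" "d q = 1" "d r = 1"
  shows "realizations (insert p (insert q (insert r V))) d = 3 * (\<Sum>u\<in>V. realizations V (lower {u} d)) +
    (\<Sum>u\<in>V. \<Sum>w\<in>V. \<Sum>x\<in>V. realizations V (lower {x} (lower {w} (lower {u} d))))"
proof -
  \<comment> \<open>Here \<open>s\<close> is the leaf already joined to \<open>p\<close>, and
    \<open>t\<close> is the one still to be attached.\<close>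
  have edge: "realizations (insert s (insert t V)) (lower {s} d) = (\<Sum>u\<in>V. realizations V (lower {u} d))"
    if "s \<notin> V" "t \<notin> V" "s \<noteq> t" "d s = 1" "d t = 1" for s t
  proof -
    have "realizations (insert s (insert t V)) (lower {s} d) = realizations (insert t V) (lower {s} d)"
      using V that by (intro realizations_insert_0) (auto simp: lower_def)
    also have "\<dots> = realizations (insert t V) d" using that by (intro realizations_cong) (auto simp: lower_def)
    finally show ?thesis using V that realizations_insert_leaf by simp
  qed
  have "realizations (insert p (insert q (insert r V))) d =
      realizations (insert q (insert r V)) (lower {q} d) + realizations (insert r (insert q V)) (lower {r} d)
        + (\<Sum>u\<in>V. realizations (insert q (insert r V)) (lower {u} d))"
    using assms by (subst realizations_insert_leaf) (auto simp: insert_commute)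
  also have "(\<Sum>u\<in>V. realizations (insert q (insert r V)) (lower {u} d)) =
      (\<Sum>u\<in>V. realizations V (lower {u} d) + (\<Sum>w\<in>V. \<Sum>x\<in>V. realizations V (lower {x} (lower {w} (lower {u} d)))))"
    using assms by (intro sum.cong refl realizations_insert_two_leaves) (auto simp: lower_def)
  finally show ?thesis using assms edge[of q r] edge[of r q] by (simp add: sum.distrib)
qed

section \<open>Graphs with vertices of degree 3 and 1\<close>

text \<open>This is the number N(a, s) of the overview, for one fixed choice of the prescribed
  vertices.\<close>

definition cubic_leaf :: "nat \<Rightarrow> nat \<Rightarrow> nat" where
  "cubic_leaf a s = realizations {..<a + s} (\<lambda>i. if i < a then 3 else 1)"

text \<open>Vertices of degree 0 are allowed: lowering the degrees of the neighbours creates them.\<close>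

definition profile :: "nat set \<Rightarrow> (nat \<Rightarrow> int) \<Rightarrow> nat \<Rightarrow> nat \<Rightarrow> bool" where
  "profile V d a s \<longleftrightarrow> finite V \<and> (\<forall>v\<in>V. d v \<in> {0, 1, 3}) \<and>
     card {v \<in> V. d v = 3} = a \<and> card {v \<in> V. d v = 1} = s"

text \<open>Vertices of degree 0 are dropped and the others relabelled, so only the two numbers
  matter.\<close>

lemma realizations_profile:
  assumes "profile V d a s"
  shows "realizations V d = cubic_leaf a s"
proof -
  let ?A = "{v \<in> V. d v = 3}" and ?B = "{v \<in> V. d v = 1}"
  have V: "finite V" "\<And>v. v \<in> V \<Longrightarrow> d v \<in> {0, 1, 3}" "card ?A = a" "card ?B = s"
    using assms by (auto simp: profile_def)
  obtain f where f: "bij_betw f {..<a} ?A"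
    using finite_same_card_bij[of "{..<a}" ?A] V by auto
  obtain g where g: "bij_betw g {a..<a+s} ?B"
    using finite_same_card_bij[of "{a..<a+s}" ?B] V by auto
  define h where "h = (\<lambda>i. if i \<in> {..<a} then f i else g i)"
  have "bij_betw h ({..<a} \<union> {a..<a+s}) (?A \<union> ?B)"
    unfolding h_def by (intro bij_betw_disjoint_Un f g) auto
  moreover have "{..<a} \<union> {a..<a+s} = {..<a+s}" by auto
  moreover have "?A \<union> ?B = V - {v \<in> V. d v = 0}" using V(2) by fastforce
  ultimately have h: "bij_betw h {..<a+s} (V - {v \<in> V. d v = 0})" by simp
  have "realizations V d = realizations (V - {v \<in> V. d v = 0}) d"
    using V by (intro realizations_remove_zeros) auto
  also have "\<dots> = cubic_leaf a s"
    unfolding cubic_leaf_def using f g by (intro realizations_bij[OF h]) (auto simp: h_def bij_betw_def)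
  finally show ?thesis .
qed

lemma profile_insert:
  assumes "profile V d a s" "v \<notin> V"
  shows "d v = 0 \<Longrightarrow> profile (insert v V) d a s"
    and "d v = 1 \<Longrightarrow> profile (insert v V) d a (Suc s)"
    and "d v = 3 \<Longrightarrow> profile (insert v V) d (Suc a) s"
proof -
  have fin: "finite V" using assms by (simp add: profile_def)
  have "{w \<in> insert v V. d w = c} = (if d v = c then insert v {w \<in> V. d w = c} else {w \<in> V. d w = c})" for c
    by auto
  then have "card {w \<in> insert v V. d w = c} = card {w \<in> V. d w = c} + of_bool (d v = c)" for c
    using fin assms(2) by simp
  then show "d v = 0 \<Longrightarrow> profile (insert v V) d a s"
    and "d v = 1 \<Longrightarrow> profile (insert v V) d a (Suc s)"
    and "d v = 3 \<Longrightarrow> profile (insert v V) d (Suc a) s"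
    using assms fin by (simp_all add: profile_def)
qed

lemma profile_cong: "(\<And>v. v \<in> V \<Longrightarrow> d v = d' v) \<Longrightarrow> profile V d a s \<longleftrightarrow> profile V d' a s"
proof -
  assume *: "\<And>v. v \<in> V \<Longrightarrow> d v = d' v"
  then have "{v \<in> V. d v = c} = {v \<in> V. d' v = c}" for c by auto
  with * show ?thesis by (simp add: profile_def)
qed

lemma profile_remove:
  assumes "profile V d a s" "v \<in> V"
  shows "d v = 3 \<Longrightarrow> profile (V - {v}) d (a - 1) s \<and> a > 0" "d v = 1 \<Longrightarrow> profile (V - {v}) d a (s - 1) \<and> s > 0"
proof -
  have fin: "finite V" using assms by (simp add: profile_def)
  have "{w \<in> V - {v}. d w = c} = {w \<in> V. d w = c} - (if d v = c then {v} else {})" for c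
    by auto
  then have "card {w \<in> V - {v}. d w = c} = card {w \<in> V. d w = c} - of_bool (d v = c)" for c
    using fin assms(2) by simp
  moreover have "card {w \<in> V. d w = d v} > 0" using fin assms(2) by (auto simp: card_gt_0_iff)
  ultimately show "d v = 3 \<Longrightarrow> profile (V - {v}) d (a - 1) s \<and> a > 0"
    "d v = 1 \<Longrightarrow> profile (V - {v}) d a (s - 1) \<and> s > 0"
    using assms fin by (simp_all add: profile_def)
qed


lemma profile_update:
  assumes "profile (V - {u}) d a s" "u \<in> V" "\<And>v. v \<in> V - {u} \<Longrightarrow> d' v = d v"
  shows "d' u = 0 \<Longrightarrow> profile V d' a s" "d' u = 1 \<Longrightarrow> profile V d' a (Suc s)"
proof -
  have "profile (V - {u}) d' a s" using assms(1) profile_cong[of "V - {u}" d d'] assms(3) by simp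
  then show "d' u = 0 \<Longrightarrow> profile V d' a s" "d' u = 1 \<Longrightarrow> profile V d' a (Suc s)"
    using profile_insert[of "V - {u}" d' a s u] insert_Diff[OF assms(2)] by auto
qed

text \<open>Stated over a semiring because it serves for sums in \<open>nat\<close> as well as in
  \<open>int\<close>.\<close>

lemma sum_profile:
  fixes f :: "nat \<Rightarrow> 'a::comm_semiring_1"
  assumes "profile V d a s"
    and "\<And>u. u \<in> V \<Longrightarrow> d u = 3 \<Longrightarrow> f u = K" "\<And>u. u \<in> V \<Longrightarrow> d u = 1 \<Longrightarrow> f u = L"
    and "\<And>u. u \<in> V \<Longrightarrow> d u = 0 \<Longrightarrow> f u = 0"
  shows "(\<Sum>u\<in>V. f u) = of_nat a * K + of_nat s * L"
proof -
  have fin: "finite V" and d: "\<And>v. v \<in> V \<Longrightarrow> d v \<in> {0, 1, 3}" using assms(1) by (auto simp: profile_def)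
  have "(\<Sum>u\<in>V. f u) = (\<Sum>u\<in>V. (if d u = 3 then K else 0) + (if d u = 1 then L else 0))"
    using assms(2-4) d by (intro sum.cong) fastforce+
  also have "\<dots> = of_nat (card {u \<in> V. d u = 3}) * K + of_nat (card {u \<in> V. d u = 1}) * L"
    using fin by (simp add: sum.distrib sum.If_cases Int_def)
  finally show ?thesis using assms(1) by (simp add: profile_def)
qed

section \<open>Sums over repeatedly lowered degrees\<close>

lemma realizations_lower_cong:
  "v \<notin> V \<Longrightarrow> realizations V (lower {u} (d(v := c))) = realizations V (lower {u} d)"
  by (rule realizations_cong) (auto simp: lower_def)

text \<open>The leaf expansion read backwards: \<open>u\<close> runs over the possible neighbours of
  a fresh leaf \<open>p\<close>.\<close>

lemma sum_lower:
  assumes "profile V d a s"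
  shows "(\<Sum>u\<in>V. realizations V (lower {u} d)) = cubic_leaf a (s + 1)"
proof -
  have fin: "finite V" using assms by (simp add: profile_def)
  obtain p where p: "p \<notin> V" using ex_new_if_finite[OF infinite_UNIV_nat fin] by blast
  define d' where "d' = d(p := 1)"
  have d': "d' v = d v" if "v \<in> V" for v using that p by (auto simp: d'_def)
  have "profile V d' a s" using assms profile_cong[of V d d'] d' by auto
  then have "cubic_leaf a (s + 1) = realizations (insert p V) d'"
    using realizations_profile[OF profile_insert(2), of V d' a s p] p by (simp add: d'_def)
  also have "\<dots> = (\<Sum>u\<in>V. realizations V (lower {u} d'))"
    using fin p by (intro realizations_insert_leaf) (auto simp: d'_def)
  also have "\<dots> = (\<Sum>u\<in>V. realizations V (lower {u} d))"
    using p by (simp add: d'_def realizations_lower_cong)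
  finally show ?thesis by simp
qed

text \<open>Two fresh leaves are added; \<open>cubic_leaf a s\<close> accounts for the graphs in
  which they are adjacent.\<close>

lemma sum_lower_2:
  assumes "profile V d a s"
  shows "cubic_leaf a s + (\<Sum>u\<in>V. \<Sum>w\<in>V. realizations V (lower {w} (lower {u} d))) = cubic_leaf a (s + 2)"
proof -
  have fin: "finite V" using assms by (simp add: profile_def)
  obtain p where p: "p \<notin> V" using ex_new_if_finite[OF infinite_UNIV_nat fin] by blast
  obtain q where q: "q \<notin> V" "q \<noteq> p" using ex_new_if_finite[OF infinite_UNIV_nat, of "insert p V"] fin by auto
  define d' where "d' = d(p := 1, q := 1)"
  have d': "d' v = d v" if "v \<in> V" for v using that p q by (auto simp: d'_def)
  have pr: "profile V d' a s" using assms profile_cong[of V d d'] d' by auto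
  then have "cubic_leaf a (s + 2) = realizations (insert p (insert q V)) d'"
    using realizations_profile[OF profile_insert(2)[OF profile_insert(2)[OF pr q(1)]], of p] p q by (simp add: d'_def)
  also have "\<dots> = realizations V d' + (\<Sum>u\<in>V. \<Sum>w\<in>V. realizations V (lower {w} (lower {u} d')))"
    using fin p q by (intro realizations_insert_two_leaves) (auto simp: d'_def)
  also have "\<dots> = cubic_leaf a s + (\<Sum>u\<in>V. \<Sum>w\<in>V. realizations V (lower {w} (lower {u} d)))"
    using realizations_profile[OF pr] d' by (auto intro!: sum.cong realizations_cong simp: lower_def)
  finally show ?thesis by simp
qed

text \<open>Three fresh leaves are added; if two of them are adjacent, the third is just one
  additional leaf.\<close>

lemma sum_lower_3:
  assumes "profile V d a s"
  shows "3 * cubic_leaf a (s + 1) + (\<Sum>u\<in>V. \<Sum>w\<in>V. \<Sum>x\<in>V. realizations V (lower {x} (lower {w} (lower {u} d)))) = cubic_leaf a (s + 3)"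
proof -
  have fin: "finite V" using assms by (simp add: profile_def)
  obtain p where p: "p \<notin> V" using ex_new_if_finite[OF infinite_UNIV_nat fin] by blast
  obtain q where q: "q \<notin> V" "q \<noteq> p" using ex_new_if_finite[OF infinite_UNIV_nat, of "insert p V"] fin by auto
  obtain r where r: "r \<notin> V" "r \<noteq> p" "r \<noteq> q"
    using ex_new_if_finite[OF infinite_UNIV_nat, of "insert p (insert q V)"] fin by auto
  define d' where "d' = d(p := 1, q := 1, r := 1)"
  have d': "d' v = d v" if "v \<in> V" for v using that p q r by (auto simp: d'_def)
  have pr: "profile V d' a s" using assms profile_cong[of V d d'] d' by auto
  then have "cubic_leaf a (s + 3) = realizations (insert p (insert q (insert r V))) d'"
    using realizations_profile[OF profile_insert(2)[OF profile_insert(2)[OF profile_insert(2)[OF pr r(1)]]], of q p] p q r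
    by (simp add: d'_def eval_nat_numeral)
  also have "\<dots> = 3 * (\<Sum>u\<in>V. realizations V (lower {u} d')) +
      (\<Sum>u\<in>V. \<Sum>w\<in>V. \<Sum>x\<in>V. realizations V (lower {x} (lower {w} (lower {u} d'))))"
    using fin p q r by (intro realizations_insert_three_leaves) (auto simp: d'_def)
  also have "\<dots> = 3 * cubic_leaf a (s + 1) + (\<Sum>u\<in>V. \<Sum>w\<in>V. \<Sum>x\<in>V. realizations V (lower {x} (lower {w} (lower {u} d))))"
    using sum_lower[OF pr] d' by (auto intro!: sum.cong realizations_cong simp: lower_def)
  finally show ?thesis by simp
qed

lemma profile_lower_twice:
  assumes "profile V d a s" "u \<in> V" "d u = 3"
  shows "profile V (lower {u} (lower {u} d)) (a - 1) (s + 1)"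
  using profile_update(2)[of V u d "a - 1" s] profile_remove(1)[OF assms(1,2)] assms by (simp add: lower_def)

lemma realizations_lower_twice_eq_0:
  assumes "u \<in> V" "d u \<le> 1"
  shows "realizations V (lower {u} (lower {u} d)) = 0"
  using assms by (intro realizations_negative[of u]) (auto simp: lower_def)

text \<open>The diagonal of the double sum. Only a cubic vertex can be lowered twice, and it becomes
  a leaf. For \<open>a = 0\<close> the factor \<open>a\<close> makes the truncated
  \<open>a - 1\<close> harmless.\<close>

lemma sum_lower_twice:
  assumes "profile V d a s"
  shows "(\<Sum>u\<in>V. realizations V (lower {u} (lower {u} d))) = a * cubic_leaf (a - 1) (s + 1)"
  using sum_profile[OF assms, of "\<lambda>u. realizations V (lower {u} (lower {u} d))" "cubic_leaf (a - 1) (s + 1)" 0]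
    realizations_profile[OF profile_lower_twice[OF assms]]
  by (simp add: realizations_lower_twice_eq_0)

text \<open>Two of three neighbours coincide. The vertex \<open>u\<close> has become a leaf, and
  \<open>sum_lower\<close> for the new profile accounts for the third neighbour.\<close>

lemma sum_lower_twice_once:
  assumes "profile V d a s"
  shows "(\<Sum>u\<in>V. \<Sum>w\<in>V. realizations V (lower {w} (lower {u} (lower {u} d)))) = a * cubic_leaf (a - 1) (s + 2)"
proof -
  have "(\<Sum>w\<in>V. realizations V (lower {w} (lower {u} (lower {u} d)))) = 0" if "u \<in> V" "d u \<le> 1" for u
    using that by (intro sum.neutral ballI realizations_negative[of u]) (auto simp: lower_def)
  then show ?thesis
    using sum_profile[OF assms, of "\<lambda>u. \<Sum>w\<in>V. realizations V (lower {w} (lower {u} (lower {u} d)))" "cubic_leaf (a - 1) (s + 2)" 0]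
      sum_lower[OF profile_lower_twice[OF assms]]
    by simp
qed

text \<open>All three neighbours coincide: a cubic vertex is used up and drops to degree 0.\<close>

lemma sum_lower_thrice:
  assumes "profile V d a s"
  shows "(\<Sum>u\<in>V. realizations V (lower {u} (lower {u} (lower {u} d)))) = a * cubic_leaf (a - 1) s"
proof -
  have "realizations V (lower {u} (lower {u} (lower {u} d))) = 0" if "u \<in> V" "d u \<le> 1" for u
    using that by (intro realizations_negative[of u]) (auto simp: lower_def)
  moreover have "realizations V (lower {u} (lower {u} (lower {u} d))) = cubic_leaf (a - 1) s" if "u \<in> V" "d u = 3" for u
    using profile_update(1)[of V u d "a - 1" s] profile_remove(1)[OF assms that(1)] that
    by (intro realizations_profile) (simp add: lower_def)
  ultimately show ?thesis
    using sum_profile[OF assms, of "\<lambda>u. realizations V (lower {u} (lower {u} (lower {u} d)))" "cubic_leaf (a - 1) s" 0]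
    by simp
qed

text \<open>
  Two leaves \<open>p\<close>, \<open>q\<close> are adjacent, or hang on the same cubic vertex, or can be merged into a vertex of
  degree 2; each graph with a vertex of degree 2 arises from two such mergers.
\<close>

lemma split_degree_2:
  assumes "profile V d a s" "v \<notin> V" "d v = 2"
  shows "2 * realizations (insert v V) d + a * cubic_leaf (a - 1) (s + 1) + cubic_leaf a s = cubic_leaf a (s + 2)"
proof -
  have fin: "finite V" using assms by (simp add: profile_def)
  have "(\<Sum>u\<in>V. \<Sum>w\<in>V. realizations V (lower {w} (lower {u} d))) =
      (\<Sum>u\<in>V. realizations V (lower {u} (lower {u} d)) + (\<Sum>w\<in>V-{u}. realizations V (lower {w} (lower {u} d))))"
    using fin by (intro sum.cong refl sum.remove)
  then show ?thesis
    using sum_lower_2[OF assms(1)] sum_lower_twice[OF assms(1)] realizations_insert_degree_2[of V v d, OF fin assms(2,3)]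
    by (simp add: sum.distrib)
qed

section \<open>The two recurrences without vertices of degree 2\<close>

text \<open>Inclusion-exclusion. By symmetry the three ways for two entries to coincide give equal
  sums; constant triples are then removed three times instead of once, hence the last term.\<close>

lemma sum_distinct_triples:
  fixes g :: "'a \<Rightarrow> 'a \<Rightarrow> 'a \<Rightarrow> 'b::comm_ring_1"
  assumes "finite V" and sym: "\<And>u w x. g u w x = g w u x" "\<And>u w x. g u w x = g u x w"
  shows "(\<Sum>u\<in>V. \<Sum>w\<in>V-{u}. \<Sum>x\<in>V-{u}-{w}. g u w x) =
    (\<Sum>u\<in>V. \<Sum>w\<in>V. \<Sum>x\<in>V. g u w x) - 3 * (\<Sum>u\<in>V. \<Sum>w\<in>V. g u u w) + 2 * (\<Sum>u\<in>V. g u u u)"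
proof -
  \<comment> \<open>For fixed \<open>u\<close>, the cases \<open>w = u\<close> and
    \<open>x = u\<close> give the same sum; the case \<open>x = w\<close> matches them only after
    summation over \<open>u\<close>.\<close>
  have "(\<Sum>w\<in>V-{u}. \<Sum>x\<in>V-{u}-{w}. g u w x) =
      (\<Sum>w\<in>V. \<Sum>x\<in>V. g u w x) - 2 * (\<Sum>w\<in>V. g u u w) - (\<Sum>w\<in>V. g w w u) + 2 * g u u u"
    if u: "u \<in> V" for u
  proof -
    have twice: "g u w u = g u u w" "g u w w = g w w u" for w using sym by metis+
    have "(\<Sum>w\<in>V-{u}. \<Sum>x\<in>V-{u}-{w}. g u w x) = (\<Sum>w\<in>V-{u}. (\<Sum>x\<in>V. g u w x) - g u w u - g u w w)"
      using assms(1) u by (intro sum.cong) (auto simp: sum_diff1)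
    also have "\<dots> = (\<Sum>w\<in>V. (\<Sum>x\<in>V. g u w x) - g u w u - g u w w) - ((\<Sum>x\<in>V. g u u x) - g u u u - g u u u)"
      using assms(1) u by (simp add: sum_diff1)
    also have "(\<Sum>w\<in>V. (\<Sum>x\<in>V. g u w x) - g u w u - g u w w) =
        (\<Sum>w\<in>V. \<Sum>x\<in>V. g u w x) - (\<Sum>w\<in>V. g u u w) - (\<Sum>w\<in>V. g w w u)"
      by (simp add: sum_subtractf twice)
    finally show ?thesis by (simp add: algebra_simps)
  qed
  then have "(\<Sum>u\<in>V. \<Sum>w\<in>V-{u}. \<Sum>x\<in>V-{u}-{w}. g u w x) =
      (\<Sum>u\<in>V. (\<Sum>w\<in>V. \<Sum>x\<in>V. g u w x) - 2 * (\<Sum>w\<in>V. g u u w) - (\<Sum>w\<in>V. g w w u) + 2 * g u u u)"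
    by simp
  also have "\<dots> = (\<Sum>u\<in>V. \<Sum>w\<in>V. \<Sum>x\<in>V. g u w x) - 2 * (\<Sum>u\<in>V. \<Sum>w\<in>V. g u u w)
      - (\<Sum>u\<in>V. \<Sum>w\<in>V. g w w u) + 2 * (\<Sum>u\<in>V. g u u u)"
    by (simp add: sum.distrib sum_subtractf sum_distrib_left)
  also have "(\<Sum>u\<in>V. \<Sum>w\<in>V. g w w u) = (\<Sum>u\<in>V. \<Sum>w\<in>V. g u u w)" by (rule sum.swap)
  finally show ?thesis by (simp add: algebra_simps)
qed

lemma profile_standard: "profile {..<a + s} (\<lambda>i. if i < a then 3 else 1) a s"
proof -
  have "{v \<in> {..<a + s}. (if v < a then 3 else 1) = (3::int)} = {..<a}"
    "{v \<in> {..<a + s}. (if v < a then 3 else 1) = (1::int)} = {a..<a+s}" by auto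
  then show ?thesis by (simp add: profile_def)
qed

text \<open>A cubic vertex needs three distinct neighbours, whereas three leaves put in its place
  may share them. The coincidences are corrected by inclusion-exclusion.\<close>

lemma cubic_leaf_split_cubic:
  "int (cubic_leaf n (s + 3)) = 6 * int (cubic_leaf (n + 1) s) + 3 * int (cubic_leaf n (s + 1))
     + 3 * int n * int (cubic_leaf (n - 1) (s + 2)) - 2 * int n * int (cubic_leaf (n - 1) s)"
proof -
  define V where "V = {..<n + s}"
  define v where "v = n + s"
  define d :: "nat \<Rightarrow> int" where "d = (\<lambda>i. if i < n then 3 else 1)(v := 3)"
  have v: "v \<notin> V" "d v = 3" by (auto simp: V_def v_def d_def)
  have fin: "finite V" by (simp add: V_def)
  have pr: "profile V d n s"
    using profile_standard[of n s] profile_cong[of V "\<lambda>i. if i < n then 3 else 1" d]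
    by (auto simp: V_def d_def v_def)
  have "6 * int (cubic_leaf (n + 1) s) = int (6 * realizations (insert v V) d)"
    using realizations_profile[OF profile_insert(3)[OF pr v]] by simp
  also have "\<dots> = (\<Sum>u\<in>V. \<Sum>w\<in>V-{u}. \<Sum>x\<in>V-{u}-{w}. int (realizations V (lower {x} (lower {w} (lower {u} d)))))"
    unfolding realizations_insert_degree_3[of V v d, OF fin v] by simp
  also have "\<dots> = int (\<Sum>u\<in>V. \<Sum>w\<in>V. \<Sum>x\<in>V. realizations V (lower {x} (lower {w} (lower {u} d))))
      - 3 * int (n * cubic_leaf (n - 1) (s + 2)) + 2 * int (n * cubic_leaf (n - 1) s)"
    \<comment> \<open>The order of the lowerings is irrelevant, which is the symmetry that
      \<open>sum_distinct_triples\<close> asks for.\<close>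
    unfolding sum_lower_twice_once[OF pr, symmetric] sum_lower_thrice[OF pr, symmetric] of_nat_sum
    using fin by (intro sum_distinct_triples) (simp_all only: lower_commute)
  finally show ?thesis using arg_cong[OF sum_lower_3[OF pr], of int] by simp
qed

text \<open>One of the \<open>t + 2\<close> leaves is removed. A leaf as its neighbour drops to
  degree 0; a cubic neighbour is left with degree 2, which \<open>split_degree_2\<close> eliminates
  at the cost of the factor 2.\<close>

lemma cubic_leaf_remove_leaf:
  "2 * int (cubic_leaf (n + 1) (t + 2)) = 2 * int (t + 1) * int (cubic_leaf (n + 1) t) + int (n + 1) *
     (int (cubic_leaf n (t + 3)) - int (cubic_leaf n (t + 1)) - int n * int (cubic_leaf (n - 1) (t + 2)))"
proof -
  \<comment> \<open>The removed leaf is already missing from \<open>V\<close>, so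
    \<open>t + 1\<close> leaves remain.\<close>
  define V where "V = {..<(n + 1) + (t + 1)}"
  define d :: "nat \<Rightarrow> int" where "d = (\<lambda>i. if i < n + 1 then 3 else 1)"
  have pr: "profile V d (n + 1) (t + 1)" using profile_standard[of "n + 1" "t + 1"] by (simp add: V_def d_def)
  have fin: "finite V" by (simp add: V_def)
  have cubic: "2 * int (realizations V (lower {u} d)) =
      int (cubic_leaf n (t + 3)) - int (cubic_leaf n (t + 1)) - int n * int (cubic_leaf (n - 1) (t + 2))"
    if u: "u \<in> V" "d u = 3" for u
  proof -
    have "profile (V - {u}) d n (t + 1)" using profile_remove(1)[OF pr u(1)] u by simp
    then have "profile (V - {u}) (lower {u} d) n (t + 1)"
      using profile_cong[of "V - {u}" d "lower {u} d"] by (simp add: lower_def)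
    from split_degree_2[OF this, of u] have "2 * realizations V (lower {u} d) + n * cubic_leaf (n - 1) (t + 2) + cubic_leaf n (t + 1) = cubic_leaf n (t + 3)"
      using u insert_Diff[of u V] by (simp add: lower_def numeral_3_eq_3)
    then have "int (2 * realizations V (lower {u} d) + n * cubic_leaf (n - 1) (t + 2) + cubic_leaf n (t + 1)) = int (cubic_leaf n (t + 3))"
      by (simp only:)
    then show ?thesis by simp
  qed
  have leaf: "realizations V (lower {u} d) = cubic_leaf (n + 1) t" if "u \<in> V" "d u = 1" for u
    using profile_update(1)[of V u d "n + 1" t] profile_remove(2)[OF pr that(1)] that
    by (intro realizations_profile) (simp add: lower_def)
  have "2 * int (cubic_leaf (n + 1) (t + 2)) = (\<Sum>u\<in>V. 2 * int (realizations V (lower {u} d)))"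
    using sum_lower[OF pr, symmetric] by (simp add: sum_distrib_left)
  also have "\<dots> = int (n + 1) * (int (cubic_leaf n (t + 3)) - int (cubic_leaf n (t + 1)) - int n * int (cubic_leaf (n - 1) (t + 2)))
      + int (t + 1) * (2 * int (cubic_leaf (n + 1) t))"
    by (rule sum_profile[OF pr]) (simp add: cubic, simp add: leaf, simp add: d_def split: if_splits)
  finally show ?thesis by simp
qed


section \<open>The sequence and its recurrence\<close>

text \<open>Handshake lemma: each vertex contributes 1 to the degree sum, and each vertex of
  \<open>T\<close> another 2.\<close>

lemma card_edges_3_1:
  assumes "finite V" "E \<subseteq> nsets V 2" "T \<subseteq> V" "\<And>v. v \<in> V \<Longrightarrow> vdegree E v = (if v \<in> T then 3 else 1)"
  shows "2 * card E = card V + 2 * card T"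
proof -
  have "{v \<in> V. v \<in> e} = e \<and> card e = 2" if "e \<in> E" for e
    using that assms(2) by (auto simp: nsets_def)
  then have "(\<Sum>v\<in>V. card {e \<in> E. v \<in> e}) = 2 * card E"
    using assms finite_subset[OF assms(2) finite_imp_finite_nsets] by (intro sum_multicount) auto
  moreover have "(\<Sum>v\<in>V. card {e \<in> E. v \<in> e}) = (\<Sum>v\<in>V. 1 + 2 * of_bool (v \<in> T))"
    using assms(4) by (intro sum.cong) (auto simp: vdegree_def)
  moreover have "\<dots> = card V + 2 * card T"
    unfolding sum.distrib sum_distrib_left[symmetric] using assms(1,3) by (simp add: Int_absorb1)
  ultimately show ?thesis by simp
qed

text \<open>The binomial coefficient counts the possible sets of cubic vertices; the edge count
  forces their number to be \<open>k\<close>.\<close>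

lemma a339987_Suc: "a339987 (Suc k) = (2 * k + 2 choose k) * cubic_leaf k (k + 2)"
proof -
  define V where "V = {1..2 * Suc k}"
  define d :: "nat set \<Rightarrow> nat \<Rightarrow> int" where "d = (\<lambda>T v. if v \<in> T then 3 else 1)"
  define A where "A = (\<lambda>T. {E. E \<subseteq> nsets V 2 \<and> (\<forall>v\<in>V. int (vdegree E v) = d T v)})"
  have V: "finite V" "card V = 2 * k + 2" by (simp_all add: V_def)
  \<comment> \<open>Hence having \<open>2 * k + 1\<close> edges is equivalent to
    \<open>card T = k\<close>.\<close>
  have edges: "card E = k + 1 + card T" if "T \<subseteq> V" "E \<in> A T" for T E
  proof -
    have "vdegree E v = (if v \<in> T then 3 else 1)" if "v \<in> V" for v
    proof -
      have "int (vdegree E v) = d T v" using \<open>E \<in> A T\<close> that by (simp add: A_def)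
      then show ?thesis by (simp add: d_def split: if_splits)
    qed
    then show ?thesis using card_edges_3_1[of V E T] that V by (simp add: A_def)
  qed
  \<comment> \<open>A graph determines its set of cubic vertices, so the sets \<open>A T\<close> are
    disjoint.\<close>
  have T_eq: "T = {v \<in> V. vdegree E v = 3}" if "T \<subseteq> V" "E \<in> A T" for T E
  proof -
    have "v \<in> T \<longleftrightarrow> vdegree E v = 3" if "v \<in> V" for v
    proof -
      have "int (vdegree E v) = d T v" using \<open>E \<in> A T\<close> that by (simp add: A_def)
      then show ?thesis by (simp add: d_def split: if_splits)
    qed
    then show ?thesis using that by auto
  qed
  have "{E \<in> labelled_graphs (2 * Suc k). regular_3_1 (2 * Suc k) E \<and> int (card E) = 2 * int (Suc k) - 1}
      = (\<Union>T\<in>nsets V k. A T)" (is "?X = ?Y")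
  proof
    show "?X \<subseteq> ?Y"
    proof
      fix E assume E: "E \<in> ?X"
      define T where "T = {v \<in> V. vdegree E v = 3}"
      have "E \<in> A T" using E by (auto simp: labelled_graphs_def regular_3_1_def A_def T_def d_def V_def)
      moreover have "T \<subseteq> V" by (auto simp: T_def)
      ultimately have "card T = k" using edges E by fastforce
      then show "E \<in> ?Y"
        using \<open>E \<in> A T\<close> \<open>T \<subseteq> V\<close> V finite_subset[of T V] by (auto simp: nsets_def)
    qed
    show "?Y \<subseteq> ?X"
    proof
      fix E assume "E \<in> ?Y"
      then obtain T where T: "T \<subseteq> V" "card T = k" "E \<in> A T" by (auto simp: nsets_def)
      have "vdegree E v = 3 \<or> vdegree E v = 1" if "v \<in> V" for v
      proof -
        have "int (vdegree E v) = d T v" using T(3) that by (simp add: A_def)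
        then show ?thesis by (simp add: d_def split: if_splits)
      qed
      then show "E \<in> ?X"
        using T edges[OF T(1,3)] by (simp add: labelled_graphs_def regular_3_1_def A_def V_def)
    qed
  qed
  then have "a339987 (Suc k) = card (\<Union>T\<in>nsets V k. A T)" by (simp only: a339987_def)
  also have "\<dots> = (\<Sum>T\<in>nsets V k. card (A T))"
  proof (rule card_UN_disjoint)
    show "finite (nsets V k)" using V by (simp add: finite_imp_finite_nsets)
    show "\<forall>T\<in>nsets V k. finite (A T)"
      using finite_imp_finite_nsets[OF V(1)] by (auto simp: A_def)
    show "\<forall>T\<in>nsets V k. \<forall>T'\<in>nsets V k. T \<noteq> T' \<longrightarrow> A T \<inter> A T' = {}"
    proof (intro ballI impI, rule ccontr)
      fix T T' assume *: "T \<in> nsets V k" "T' \<in> nsets V k" "T \<noteq> T'" "A T \<inter> A T' \<noteq> {}"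
      then obtain E where "E \<in> A T" "E \<in> A T'" by blast
      moreover have "T \<subseteq> V" "T' \<subseteq> V" using * by (auto simp: nsets_def)
      ultimately show False using T_eq *(3) by blast
    qed
  qed
  also have "\<dots> = (\<Sum>T\<in>nsets V k. cubic_leaf k (k + 2))"
  proof (rule sum.cong[OF refl])
    fix T assume "T \<in> nsets V k"
    then have T: "T \<subseteq> V" "card T = k" "finite T" by (auto simp: nsets_def)
    have "{v \<in> V. d T v = 3} = T" "{v \<in> V. d T v = 1} = V - T" using T by (auto simp: d_def)
    then have "profile V (d T) k (k + 2)"
      using T V by (auto simp: profile_def card_Diff_subset d_def)
    then show "card (A T) = cubic_leaf k (k + 2)" using realizations_profile by (simp add: A_def realizations_def)
  qed
  also have "\<dots> = (2 * k + 2 choose k) * cubic_leaf k (k + 2)"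
  proof -
    have "nsets V k = {T. T \<subseteq> V \<and> card T = k}" using V finite_subset by (auto simp: nsets_def)
    then show ?thesis using n_subsets[OF V(1)] V by simp
  qed
  finally show ?thesis .
qed

text \<open>
  The first index is shifted by one, so that \<open>weight 0 s = 0\<close> stands for the absent graphs with \<open>-1\<close>
  cubic vertices; the two recurrences then hold without boundary cases.
\<close>

definition weight :: "nat \<Rightarrow> nat \<Rightarrow> real" where
  "weight n s = (if n = 0 then 0 else real (cubic_leaf (n - 1) s) / (fact (n - 1) * fact s))"

section \<open>Normalized recurrences and their combination on the diagonal\<close>

text \<open>The second identity includes \<open>n = 0\<close>, where both sides vanish; this removes
  the boundary case.\<close>

lemma cubic_leaf_eq_weight:
  "real (cubic_leaf n s) = weight (n + 1) s * (fact n * fact s)"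
  "real n * real (cubic_leaf (n - 1) s) = weight n s * (fact n * fact s)"
  by (cases n; simp add: weight_def)+

lemma weight_remove_leaf:
  "2 * weight (n + 2) t - 2 * (real t + 2) * weight (n + 2) (t + 2)
    + (real t + 2) * (real t + 3) * weight (n + 1) (t + 3) - weight (n + 1) (t + 1)
    - (real t + 2) * weight n (t + 2) = 0"
proof -
  have "2 * real (cubic_leaf (n + 1) (t + 2)) = 2 * real (t + 1) * real (cubic_leaf (n + 1) t) + real (n + 1) *
     (real (cubic_leaf n (t + 3)) - real (cubic_leaf n (t + 1)) - real n * real (cubic_leaf (n - 1) (t + 2)))"
    using arg_cong[OF cubic_leaf_remove_leaf[of n t], of real_of_int] by simp
  then have "2 * (weight (n + 2) (t + 2) * (((real n + 1) * fact n) * ((real t + 2) * (real t + 1) * fact t))) =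
      2 * (real t + 1) * (weight (n + 2) t * (((real n + 1) * fact n) * fact t)) + (real n + 1) *
     (weight (n + 1) (t + 3) * (fact n * ((real t + 3) * (real t + 2) * (real t + 1) * fact t))
      - weight (n + 1) (t + 1) * (fact n * ((real t + 1) * fact t))
      - weight n (t + 2) * (fact n * ((real t + 2) * (real t + 1) * fact t)))"
    \<comment> \<open>The second identity goes first, since the first one would also rewrite
      \<open>cubic_leaf (n - 1)\<close>.\<close>
    unfolding cubic_leaf_eq_weight(2) unfolding cubic_leaf_eq_weight(1)
    by (simp add: fact_reduce numeral_2_eq_2 numeral_3_eq_3 add_ac mult_ac)
  \<comment> \<open>With all factorials reduced to those of \<open>n\<close> and \<open>t\<close>, a
    common nonzero factor can be split off.\<close>
  then have "((real n + 1) * (real t + 1) * fact n * fact t) *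
    (2 * weight (n + 2) t - 2 * (real t + 2) * weight (n + 2) (t + 2)
    + (real t + 2) * (real t + 3) * weight (n + 1) (t + 3) - weight (n + 1) (t + 1)
    - (real t + 2) * weight n (t + 2)) = 0"
    by algebra
  moreover have "(real n + 1) * (real t + 1) * fact n * fact t \<noteq> 0" by (simp add: add_eq_0_iff)
  ultimately show ?thesis by (simp only: mult_eq_0_iff) blast
qed

lemma weight_split_cubic:
  "6 * (real n + 1) * weight (n + 2) s - 2 * weight n s + 3 * (real s + 1) * weight (n + 1) (s + 1)
    + 3 * (real s + 1) * (real s + 2) * weight n (s + 2)
    - (real s + 1) * (real s + 2) * (real s + 3) * weight (n + 1) (s + 3) = 0"
proof -
  have "real (cubic_leaf n (s + 3)) = 6 * real (cubic_leaf (n + 1) s) + 3 * real (cubic_leaf n (s + 1))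
     + 3 * (real n * real (cubic_leaf (n - 1) (s + 2))) - 2 * (real n * real (cubic_leaf (n - 1) s))"
    using arg_cong[OF cubic_leaf_split_cubic[of n s], of real_of_int] by simp
  then have "weight (n + 1) (s + 3) * (fact n * ((real s + 3) * (real s + 2) * (real s + 1) * fact s)) =
      6 * (weight (n + 2) s * (((real n + 1) * fact n) * fact s))
      + 3 * (weight (n + 1) (s + 1) * (fact n * ((real s + 1) * fact s)))
      + 3 * (weight n (s + 2) * (fact n * ((real s + 2) * (real s + 1) * fact s)))
      - 2 * (weight n s * (fact n * fact s))"
    unfolding cubic_leaf_eq_weight(2) unfolding cubic_leaf_eq_weight(1)
    by (simp add: fact_reduce numeral_2_eq_2 numeral_3_eq_3 add_ac mult_ac)
  then have "(fact n * fact s) *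
    (6 * (real n + 1) * weight (n + 2) s - 2 * weight n s + 3 * (real s + 1) * weight (n + 1) (s + 1)
    + 3 * (real s + 1) * (real s + 2) * weight n (s + 2)
    - (real s + 1) * (real s + 2) * (real s + 3) * weight (n + 1) (s + 3)) = 0"
    by algebra
  moreover have "fact n * fact s \<noteq> (0 :: real)" by auto
  ultimately show ?thesis by (simp only: mult_eq_0_iff) blast
qed

text \<open>The binomial coefficient supplies exactly the factorials divided out in
  \<open>weight\<close>. For \<open>m = 0\<close> both sides are zero, as no graph has -1
  edges.\<close>

lemma a339987_weight: "real (a339987 m) = fact (2 * m) * weight m (m + 1)"
proof (cases m)
  case 0
  have "a339987 0 = 0" by (simp add: a339987_def)
  then show ?thesis using 0 by (simp add: weight_def)
next
  case (Suc k)
  have "real (2 * k + 2 choose k) = fact (2 * k + 2) / (fact k * fact (k + 2))"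
    using binomial_fact[of k "2 * k + 2", where 'a = real] by (simp add: algebra_simps)
  then show ?thesis using Suc by (simp add: a339987_Suc weight_def)
qed

text \<open>This is the claimed recurrence after the factorials and a common polynomial factor are
  divided out.\<close>

lemma diagonal_recurrence:
  fixes k :: nat
  defines "x \<equiv> real k" and "w \<equiv> \<lambda>i j. weight (k + i) (k + j)"
  shows "4 * (328 * x ^ 3 + 3300 * x ^ 2 + 10844 * x + 11589) * w 0 1
    - 2 * (2624 * x ^ 4 + 30664 * x ^ 3 + 129460 * x ^ 2 + 232328 * x + 148119) * w 1 2
    - 8 * (x + 3) * (2952 * x ^ 5 + 40852 * x ^ 4 + 219308 * x ^ 3 + 569267 * x ^ 2 + 712135 * x + 341634) * w 2 3
    + 8 * (x + 3) * (x + 4) * (3936 * x ^ 5 + 55672 * x ^ 4 + 306380 * x ^ 3 + 818282 * x ^ 2 + 1057879 * x + 527520) * w 3 4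
    - 4 * (x + 3) * (x + 4) * (x + 5) * (2624 * x ^ 5 + 42472 * x ^ 4 + 264028 * x ^ 3 + 786236 * x ^ 2 + 1117119 * x + 601452) * w 4 5
    + 12 * (x + 3) * (x + 4)^2 * (x + 5) * (x + 6) * (328 * x ^ 3 + 2316 * x ^ 2 + 5228 * x + 3717) * w 5 6 = 0" (is "?lhs = 0")
proof -
  \<comment> \<open>\<open>L i j\<close> and \<open>C i j\<close> are the left sides of the two
    weight recurrences at offsets \<open>i\<close>, \<open>j\<close>. Each links only entries whose
    indices have sums of equal parity, so offsets with \<open>i + j\<close> odd suffice; the entries
    off the diagonal cancel in the combination.\<close>
  define L where "L = (\<lambda>i j. 2 * w (i + 2) j - 2 * (x + real j + 2) * w (i + 2) (j + 2)
      + (x + real j + 2) * (x + real j + 3) * w (i + 1) (j + 3) - w (i + 1) (j + 1)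
      - (x + real j + 2) * w i (j + 2))"
  define C where "C = (\<lambda>i j. 6 * (x + real i + 1) * w (i + 2) j - 2 * w i j + 3 * (x + real j + 1) * w (i + 1) (j + 1)
      + 3 * (x + real j + 1) * (x + real j + 2) * w i (j + 2)
      - (x + real j + 1) * (x + real j + 2) * (x + real j + 3) * w (i + 1) (j + 3))"
  have L: "L i j = 0" for i j
    using weight_remove_leaf[of "k + i" "k + j"] by (simp only: L_def w_def x_def of_nat_add add.assoc)
  have C: "C i j = 0" for i j
    using weight_split_cubic[of "k + i" "k + j"] by (simp only: C_def w_def x_def of_nat_add add.assoc)
  \<comment> \<open>The multipliers were found by linear algebra over the rational functions in \<open>x\<close>.\<close>
  have "?lhs =
      - (1968 * x ^ 4 + 23736 * x ^ 3 + 104664 * x ^ 2 + 199662 * x + 139068) * L 0 1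
      + (6560 * x ^ 5 + 95848 * x ^ 4 + 547108 * x ^ 3 + 1519688 * x ^ 2 + 2043273 * x + 1054935) * L 1 2
      + (11808 * x ^ 5 + 171936 * x ^ 4 + 978120 * x ^ 3 + 2708532 * x ^ 2 + 3634146 * x + 1877418) * L 2 1
      + (3936 * x ^ 6 + 70104 * x ^ 5 + 511380 * x ^ 4 + 1952160 * x ^ 3 + 4104105 * x ^ 2 + 4491603 * x + 1990332) * L 2 3
      - (7872 * x ^ 6 + 144144 * x ^ 5 + 1079448 * x ^ 4 + 4222872 * x ^ 3 + 9076830 * x ^ 2 + 10123506 * x + 4549608) * L 3 2
      - (1968 * x ^ 7 + 45384 * x ^ 6 + 440664 * x ^ 5 + 2332374 * x ^ 4 + 7255320 * x ^ 3 + 13232994 * x ^ 2 + 13059216 * x + 5352480) * L 3 4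
      - (656 * x ^ 3 + 6600 * x ^ 2 + 21688 * x + 23178) * C 0 1
      + (2624 * x ^ 4 + 30664 * x ^ 3 + 129460 * x ^ 2 + 232328 * x + 148119) * C 1 2
      - (3936 * x ^ 4 + 45504 * x ^ 3 + 189528 * x ^ 2 + 334260 * x + 208602) * C 2 1
      - (984 * x ^ 4 + 10572 * x ^ 3 + 40860 * x ^ 2 + 66555 * x + 37665) * C 2 3
      + (2624 * x ^ 5 + 37552 * x ^ 4 + 209608 * x ^ 3 + 569192 * x ^ 2 + 748842 * x + 379134) * C 3 2
      - (1968 * x ^ 6 + 35544 * x ^ 5 + 262944 * x ^ 4 + 1017654 * x ^ 3 + 2167050 * x ^ 2 + 2397744 * x + 1070496) * C 3 4"
    \<comment> \<open>Index arithmetic is evaluated first, so that equal entries of \<open>w\<close>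
      become identical atoms for \<open>algebra\<close>.\<close>
    unfolding L_def C_def add_0_left one_add_one one_plus_numeral numeral_plus_one numeral_plus_numeral
      add_num_simps of_nat_0 of_nat_1 of_nat_numeral
    by algebra
  then show ?thesis by (simp only: L C mult_zero_right add_0_left diff_0_right minus_zero)
qed

theorem theorem1:
  fixes k :: nat
  shows
    "32 * (328 * int k ^ 3 + 3300 * int k ^ 2 + 10844 * int k + 11589) * (int k + 1) * (int k + 2) * (2 * int k + 1) * (2 * int k + 3) * (2 * int k + 5) * (2 * int k + 7) * (2 * int k + 9) * int (a339987 k)
     - 8 * (2624 * int k ^ 4 + 30664 * int k ^ 3 + 129460 * int k ^ 2 + 232328 * int k + 148119) * (int k + 2) * (2 * int k + 3) * (2 * int k + 5) * (2 * int k + 7) * (2 * int k + 9) * int (a339987 (k + 1))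
     - 16 * (2952 * int k ^ 5 + 40852 * int k ^ 4 + 219308 * int k ^ 3 + 569267 * int k ^ 2 + 712135 * int k + 341634) * (int k + 3) * (2 * int k + 5) * (2 * int k + 7) * (2 * int k + 9) * int (a339987 (k + 2))
     + 8 * (3936 * int k ^ 5 + 55672 * int k ^ 4 + 306380 * int k ^ 3 + 818282 * int k ^ 2 + 1057879 * int k + 527520) * (int k + 4) * (2 * int k + 7) * (2 * int k + 9) * int (a339987 (k + 3))
     - 2 * (2624 * int k ^ 5 + 42472 * int k ^ 4 + 264028 * int k ^ 3 + 786236 * int k ^ 2 + 1117119 * int k + 601452) * (int k + 5) * (2 * int k + 9) * int (a339987 (k + 4))
     + 3 * (328 * int k ^ 3 + 2316 * int k ^ 2 + 5228 * int k + 3717) * (int k + 4) * (int k + 6) * int (a339987 (k + 5)) = 0"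
proof -
  let "?lhs = 0" = ?thesis
  define x where "x = real k"
  define w where "w = (\<lambda>i j. weight (k + i) (k + j))"
  \<comment> \<open>\<open>F i\<close> is the factor by which the sequence at \<open>k + i\<close>
    exceeds its weight.\<close>
  define F :: "nat \<Rightarrow> real" where "F = (\<lambda>i. fact (2 * k + 2 * i))"
  have a: "real (a339987 (k + i)) = F i * w i (i + 1)" for i
    by (simp add: a339987_weight w_def F_def algebra_simps)
  have F_Suc: "F (Suc i) = (2 * x + (2 * real i + 1)) * (2 * x + (2 * real i + 2)) * F i" for i
    by (simp add: x_def F_def algebra_simps)
  have a0: "real (a339987 k) = F 0 * w 0 1"
    using a[of 0] by (simp add: numeral_eq_Suc)
  have a1: "real (a339987 (k + 1)) = F 1 * w 1 2"
    using a[of 1] by (simp add: numeral_eq_Suc)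
  have a2: "real (a339987 (k + 2)) = F 2 * w 2 3"
    using a[of 2] by (simp add: numeral_eq_Suc)
  have a3: "real (a339987 (k + 3)) = F 3 * w 3 4"
    using a[of 3] by (simp add: numeral_eq_Suc)
  have a4: "real (a339987 (k + 4)) = F 4 * w 4 5"
    using a[of 4] by (simp add: numeral_eq_Suc)
  have a5: "real (a339987 (k + 5)) = F 5 * w 5 6"
    using a[of 5] by (simp add: numeral_eq_Suc)
  have F1: "F 1 = (2 * x + 1) * (2 * x + 2) * F 0"
    using F_Suc[of 0] by (simp add: numeral_eq_Suc)
  have F2: "F 2 = (2 * x + 3) * (2 * x + 4) * F 1"
    using F_Suc[of 1] by (simp add: numeral_eq_Suc)
  have F3: "F 3 = (2 * x + 5) * (2 * x + 6) * F 2"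
    using F_Suc[of 2] by (simp add: numeral_eq_Suc)
  have F4: "F 4 = (2 * x + 7) * (2 * x + 8) * F 3"
    using F_Suc[of 3] by (simp add: numeral_eq_Suc)
  have F5: "F 5 = (2 * x + 9) * (2 * x + 10) * F 4"
    using F_Suc[of 4] by (simp add: numeral_eq_Suc)
  \<comment> \<open>Once \<open>F 1\<close> to \<open>F 5\<close> are reduced to \<open>F 0\<close>,
    all six terms share the displayed factor in front of the diagonal recurrence.\<close>
  have "real_of_int ?lhs =
      8 * (x + 1) * (x + 2) * (2 * x + 1) * (2 * x + 3) * (2 * x + 5) * (2 * x + 7) * (2 * x + 9) * F 0 *
      (4 * (328 * x ^ 3 + 3300 * x ^ 2 + 10844 * x + 11589) * w 0 1
    - 2 * (2624 * x ^ 4 + 30664 * x ^ 3 + 129460 * x ^ 2 + 232328 * x + 148119) * w 1 2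
    - 8 * (x + 3) * (2952 * x ^ 5 + 40852 * x ^ 4 + 219308 * x ^ 3 + 569267 * x ^ 2 + 712135 * x + 341634) * w 2 3
    + 8 * (x + 3) * (x + 4) * (3936 * x ^ 5 + 55672 * x ^ 4 + 306380 * x ^ 3 + 818282 * x ^ 2 + 1057879 * x + 527520) * w 3 4
    - 4 * (x + 3) * (x + 4) * (x + 5) * (2624 * x ^ 5 + 42472 * x ^ 4 + 264028 * x ^ 3 + 786236 * x ^ 2 + 1117119 * x + 601452) * w 4 5
    + 12 * (x + 3) * (x + 4)^2 * (x + 5) * (x + 6) * (328 * x ^ 3 + 2316 * x ^ 2 + 5228 * x + 3717) * w 5 6)"
    unfolding of_int_add of_int_diff of_int_mult of_int_power of_int_numeral of_int_1 of_int_of_nat_eq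
      a0 a1 a2 a3 a4 a5 F5 F4 F3 F2 F1 x_def[symmetric]
    by algebra
  also have "\<dots> = 0"
    using diagonal_recurrence[of k] by (simp only: x_def w_def mult_zero_right)
  finally show ?thesis by (simp only: of_int_eq_0_iff)
qed

end
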